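(* Let $f:\mathbb{R}^d\to\mathbb{R}$ be a convex (possibly non-smooth) function with a minimizer $x^*$. Let $(q_n)_{n\ge0}$ be a sequence of non-negative real numbers satisfying $q_0=0$ and $$(q_{n+1}+1)^2\le(q_n+2)^2+1\quad\text{for all } n\ge0,$$ and set $\alpha_n=\frac{q_n}{2+q_{n+1}}$. Let $x_0=y_0\in\mathbb{R}^d$ and let $(x_n),(y_n)$ be generated by $$x_{n+1}=y_n-\gamma_n g_n,\qquad y_{n+1}=x_{n+1}+\alpha_n(x_{n+1}-x_n),\qquad n\ge0,$$ where $\gamma_n>0$ and $g_n\in\mathbb{R}^d$ are chosen so that $\gamma_n$ is decreasing (i.e. $\gamma_{n+1}\le\gamma_n$ for all $n$) and for every $n\ge0$ $$\text{for all } z\in\mathbb{R}^d:\quad f(x_{n+1})-f(z)\le\langle g_n,y_n-z\rangle-\frac{\gamma_n}{2}\|g_n\|^2 .$$ Then for every $n$ with $q_n>0$, $$f(x_n)-f(x^* )\le\frac{2}{\gamma_n q_n(q_n+2)}\|x_0-x^*\|^2 .$$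
   Context: Here $\|\cdot\|$ and $\langle\cdot,\cdot\rangle$ are the Euclidean norm and inner product on $\mathbb{R}^d$. $f$ is not assumed differentiable, and $g_n$ is not required to be a subgradient of $f$ at $y_n$. *)

theory Defs
  imports "HOL-Analysis.Analysis"
begin

end

theory Submission
  imports Defs
begin

text \<open>
  With \<open>t\<^sub>n = (q\<^sub>n + 2) / 2\<close> the iteration is Nesterov's scheme \<open>\<alpha>\<^sub>n = (t\<^sub>n - 1) / t\<^sub>n\<^sub>+\<^sub>1\<close>, \<open>t\<^sub>0 = 1\<close>, and the
  growth condition on \<open>q\<close> reads \<open>t\<^sub>n\<^sub>+\<^sub>1 (t\<^sub>n\<^sub>+\<^sub>1 - 1) \<le> t\<^sub>n\<^sup>2\<close>. Adding \<open>t\<^sub>n - 1\<close> times the descent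
  inequality at \<open>z = x\<^sub>n\<close> to the one at \<open>z = x\<^sup>*\<close> shows that the energy
  \<open>\<gamma>\<^sub>n t\<^sub>n (t\<^sub>n - 1) (f (x\<^sub>n) - f (x\<^sup>*)) + \<parallel>u\<^sub>n\<parallel>\<^sup>2 / 2\<close> with \<open>u\<^sub>n = t\<^sub>n y\<^sub>n - (t\<^sub>n - 1) x\<^sub>n - x\<^sup>*\<close> does not
  increase. Its initial value is \<open>\<parallel>x\<^sub>0 - x\<^sup>*\<parallel>\<^sup>2 / 2\<close>.
\<close>

text \<open>The weights \<open>t - 1\<close> and \<open>1\<close> combine \<open>y - x\<close> and
  \<open>y - p\<close> into \<open>u\<close>; the further factor \<open>t * \<gamma>\<close>
  completes the square, turning the right side into half the drop from \<open>norm u\<close> squared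
  to \<open>norm (u - (t * \<gamma>) *\<^sub>R g)\<close> squared.\<close>

lemma accelerated_step_energy:
  fixes x y g p :: "'a::real_inner" and t \<gamma> F F' Fp :: real
  assumes t: "t \<ge> 1" and \<gamma>: "\<gamma> \<ge> 0"
    and at_x: "F' - F \<le> g \<bullet> (y - x) - \<gamma> / 2 * (norm g)\<^sup>2"
    and at_p: "F' - Fp \<le> g \<bullet> (y - p) - \<gamma> / 2 * (norm g)\<^sup>2"
  defines "u \<equiv> t *\<^sub>R y - (t - 1) *\<^sub>R x - p"
  shows "\<gamma> * t\<^sup>2 * (F' - Fp) + (norm (u - (t * \<gamma>) *\<^sub>R g))\<^sup>2 / 2
    \<le> \<gamma> * (t * (t - 1)) * (F - Fp) + (norm u)\<^sup>2 / 2"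
proof -
  have "(t - 1) * (F' - F) + (F' - Fp)
      \<le> (t - 1) * (g \<bullet> (y - x) - \<gamma> / 2 * (norm g)\<^sup>2) + (g \<bullet> (y - p) - \<gamma> / 2 * (norm g)\<^sup>2)"
    using t by (intro add_mono mult_left_mono at_x at_p) auto
  also have "\<dots> = g \<bullet> u - t * \<gamma> / 2 * (norm g)\<^sup>2"
    by (simp add: u_def inner_add_right inner_diff_right field_simps)
  finally have "t * \<gamma> * ((t - 1) * (F' - F) + (F' - Fp))
      \<le> t * \<gamma> * (g \<bullet> u - t * \<gamma> / 2 * (norm g)\<^sup>2)"
    using t \<gamma> by (intro mult_left_mono) auto
  moreover have "(norm (u - (t * \<gamma>) *\<^sub>R g))\<^sup>2
      = (norm u)\<^sup>2 - 2 * (t * \<gamma>) * (g \<bullet> u) + (t * \<gamma>)\<^sup>2 * (norm g)\<^sup>2"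
    unfolding power2_norm_eq_inner
    by (simp add: inner_diff_left inner_diff_right inner_commute power2_eq_square)
  ultimately show ?thesis
    by (simp add: power2_eq_square algebra_simps)
qed

theorem theorem7:
  fixes f :: "real ^ 'd \<Rightarrow> real"
    and xstar :: "real ^ 'd"
    and x y g :: "nat \<Rightarrow> real ^ 'd"
    and q \<alpha> \<gamma> :: "nat \<Rightarrow> real"
  assumes "convex_on UNIV f"
    and "\<forall>z. f xstar \<le> f z"
    and "\<forall>n. q n \<ge> 0"
    and "q 0 = 0"
    and "\<forall>n. (q (n + 1) + 1)\<^sup>2 \<le> (q n + 2)\<^sup>2 + 1"
    and "\<forall>n. \<alpha> n = q n / (2 + q (n + 1))"
    and "x 0 = y 0"
    and "\<forall>n. x (n + 1) = y n - \<gamma> n *\<^sub>R g n"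
    and "\<forall>n. y (n + 1) = x (n + 1) + \<alpha> n *\<^sub>R (x (n + 1) - x n)"
    and "\<forall>n. \<gamma> n > 0"
    and "\<forall>n. \<gamma> (n + 1) \<le> \<gamma> n"
    and "\<forall>n z. f (x (n + 1)) - f z \<le> g n \<bullet> (y n - z) - \<gamma> n / 2 * (norm (g n))\<^sup>2"
  shows "\<forall>n. q n > 0 \<longrightarrow>
    f (x n) - f xstar \<le> 2 / (\<gamma> n * q n * (q n + 2)) * (norm (x 0 - xstar))\<^sup>2"
proof (intro allI impI)
  fix n assume qn: "q n > 0"
  define t where "t k = (q k + 2) / 2" for k
  define u where "u k = t k *\<^sub>R y k - (t k - 1) *\<^sub>R x k - xstar" for k
  define D where "D k = f (x k) - f xstar" for k
  have D: "D k \<ge> 0" for k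
    using assms(2) by (simp add: D_def)
  have q: "q k \<ge> 0" for k
    using assms(3) by blast
  have \<gamma>: "\<gamma> k > 0" for k
    using assms(10) by blast
  have t_growth: "t (Suc k) * (t (Suc k) - 1) \<le> (t k)\<^sup>2" for k
    using assms(5)[rule_format, of k] by (simp add: t_def power2_eq_square field_simps)
  \<comment> \<open>The momentum \<open>\<alpha> k\<close> is tuned so that extrapolation cancels
    from \<open>u (Suc k)\<close>, leaving only the gradient step.\<close>
  have u_Suc: "u (Suc k) = u k - (t k * \<gamma> k) *\<^sub>R g k" for k
  proof -
    have "t (Suc k) * \<alpha> k = t k - 1"
      using q[of "Suc k"] assms(6) by (simp add: t_def field_simps)
    then have "t (Suc k) *\<^sub>R y (Suc k)
        = t (Suc k) *\<^sub>R x (Suc k) + (t k - 1) *\<^sub>R (x (Suc k) - x k)"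
      using assms(9) by (simp add: scaleR_add_right)
    then have "u (Suc k) = t k *\<^sub>R x (Suc k) - (t k - 1) *\<^sub>R x k - xstar"
      by (simp add: u_def algebra_simps)
    also have "x (Suc k) = y k - \<gamma> k *\<^sub>R g k"
      using assms(8) by simp
    finally show ?thesis
      by (simp add: u_def scaleR_diff_right)
  qed
  have energy: "\<gamma> k * (t k * (t k - 1)) * D k + (norm (u k))\<^sup>2 / 2 \<le> (norm (x 0 - xstar))\<^sup>2 / 2" for k
  proof (induction k)
    case 0
    show ?case
      using assms(4,7) by (simp add: t_def u_def)
  next
    case (Suc k)
    \<comment> \<open>Both the step sizes and the growth condition enter here, to pass from the
      weight left by step \<open>k\<close> to the one at \<open>Suc k\<close>.\<close>
    have "\<gamma> (Suc k) * (t (Suc k) * (t (Suc k) - 1)) \<le> \<gamma> k * (t k)\<^sup>2"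
      using assms(11) t_growth[of k] q[of "Suc k"] \<gamma>[of k]
      by (intro mult_mono) (auto simp: t_def)
    then have "\<gamma> (Suc k) * (t (Suc k) * (t (Suc k) - 1)) * D (Suc k) \<le> \<gamma> k * (t k)\<^sup>2 * D (Suc k)"
      using D by (rule mult_right_mono)
    moreover have "\<gamma> k * (t k)\<^sup>2 * D (Suc k) + (norm (u (Suc k)))\<^sup>2 / 2
        \<le> \<gamma> k * (t k * (t k - 1)) * D k + (norm (u k))\<^sup>2 / 2"
      unfolding u_Suc unfolding u_def D_def
      using q[of k] \<gamma>[of k] assms(12)
      by (intro accelerated_step_energy) (auto simp: t_def less_imp_le)
    ultimately show ?case
      using Suc.IH by linarith
  qed
  have "\<gamma> n * (t n * (t n - 1)) * D n \<le> (norm (x 0 - xstar))\<^sup>2 / 2"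
    using energy[of n] zero_le_power2[of "norm (u n)"] by linarith
  \<comment> \<open>\<open>t n * (t n - 1) = q n * (q n + 2) / 4\<close>, so the factor 1/2 becomes
    2.\<close>
  then have "D n * (\<gamma> n * q n * (q n + 2)) \<le> 2 * (norm (x 0 - xstar))\<^sup>2"
    by (simp add: t_def field_simps)
  moreover have "\<gamma> n * q n * (q n + 2) > 0"
    using qn \<gamma>[of n] by simp
  ultimately show "f (x n) - f xstar \<le> 2 / (\<gamma> n * q n * (q n + 2)) * (norm (x 0 - xstar))\<^sup>2"
    by (simp add: D_def pos_le_divide_eq)
qed

end
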